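(* There exists a closed compact $1$-dimensional submanifold $\Pi\subset\mathbb{R}^{3\times 3}$ which is elliptic and has no rank-one connection, but contains a $\mathcal{T}_4$ configuration.
   Context: A closed submanifold here is one without boundary. A $1$-submanifold $\Pi\subset\mathbb{R}^{3\times 3}$ is elliptic if for every $M\in\Pi$ the (one-dimensional, linear) tangent space $T_M\Pi\subset\mathbb{R}^{3\times 3}$ contains no matrix of rank one (i.e. all its nonzero elements have rank $>1$). $\Pi$ has no rank-one connection if there are no $M,M'\in\Pi$ with $\operatorname{rank}(M-M')=1$. A $\mathcal{T}_4$ configuration is a set of four matrices that can be ordered as $\{S_1,S_2,S_3,S_4\}$ so that $\operatorname{rank}(S_i-S_j)>1$ for all $i\neq j$, and there exist a matrix $P$, rank-one matrices $R_1,\dots,R_4$ with $R_1+R_2+R_3+R_4=0$ and real numbers $\kappa_1,\dots,\kappa_4>1$ such that $S_k=P+R_1+\dots+R_{k-1}+\kappa_kR_k$ for $k=1,2,3,4$. *)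

theory Defs
  imports "HOL-Analysis.Analysis"
begin

text \<open>Smoothness means \<open>C\<^sup>\<infinity>\<close>: \<open>D k\<close> is the \<open>k\<close>-th derivative of \<open>c\<close>. The set \<open>I\<close> is always
  open below.\<close>

definition smooth_curve_on :: "real set \<Rightarrow> (real \<Rightarrow> 'a::real_normed_vector) \<Rightarrow> bool" where
  "smooth_curve_on I c \<longleftrightarrow>
    (\<exists>D :: nat \<Rightarrow> real \<Rightarrow> 'a. D 0 = c \<and>
      (\<forall>k. \<forall>t\<in>I. (D k has_vector_derivative D (Suc k) t) (at t)))"

text \<open>Embedded smooth submanifolds of dimension one, given by local regular parametrizations that
  are homeomorphisms onto relatively open pieces. Since parameters range over open subsets of
  the line (not the half-line), such a submanifold has no boundary. Connectedness is not
  required.\<close>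

definition submanifold1 :: "'a::euclidean_space set \<Rightarrow> bool" where
  "submanifold1 M \<longleftrightarrow>
    (\<forall>p\<in>M. \<exists>V I g h. open V \<and> p \<in> V \<and> open I \<and>
      smooth_curve_on I (g :: real \<Rightarrow> 'a) \<and>
      (\<forall>t\<in>I. vector_derivative g (at t) \<noteq> 0) \<and>
      homeomorphism I (M \<inter> V) g h)"

definition tangent_space :: "'a::euclidean_space set \<Rightarrow> 'a \<Rightarrow> 'a set" where
  "tangent_space M p =
    {v. \<exists>e>0. \<exists>c. smooth_curve_on {-e<..<e} c \<and> c ` {-e<..<e} \<subseteq> M \<and> c 0 = p \<and>
      (c has_vector_derivative v) (at 0)}"

definition elliptic :: "(real^3^3) set \<Rightarrow> bool" where
  "elliptic M \<longleftrightarrow> (\<forall>p\<in>M. \<forall>A\<in>tangent_space M p. rank A \<noteq> 1)"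

definition has_rank_one_connection :: "(real^3^3) set \<Rightarrow> bool" where
  "has_rank_one_connection M \<longleftrightarrow> (\<exists>A\<in>M. \<exists>B\<in>M. rank (A - B) = 1)"

definition T4_configuration :: "(real^3^3) set \<Rightarrow> bool" where
  "T4_configuration T \<longleftrightarrow>
    (\<exists>(S :: nat \<Rightarrow> real^3^3) P (R :: nat \<Rightarrow> real^3^3) (\<kappa> :: nat \<Rightarrow> real).
      T = S ` {1..4} \<and>
      (\<forall>i\<in>{1..4}. \<forall>j\<in>{1..4}. i \<noteq> j \<longrightarrow> rank (S i - S j) > 1) \<and>
      (\<forall>k\<in>{1..4}. rank (R k) = 1) \<and>
      (\<Sum>k=1..4. R k) = 0 \<and>
      (\<forall>k\<in>{1..4}. \<kappa> k > 1) \<and>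
      (\<forall>k\<in>{1..4}. S k = P + (\<Sum>i=1..<k. R i) + \<kappa> k *\<^sub>R R k))"

end

theory Submission
  imports Defs
begin

text \<open>The submanifold may be disconnected, so four small circles suffice, one through each matrix
  of a \<open>T\<^sub>4\<close> configuration. The work lies in choosing circles that are themselves free of
  rank-one directions.

  Identify a complex number \<open>z\<close> with the conformal matrix \<open>(Re z, -Im z; Im z, Re z)\<close>, placed in the
  upper left block of a 3 by 3 matrix. Its determinant in that block is \<open>|z|\<^sup>2\<close>, so conformal
  matrices form a plane in which every nonzero element has rank two
  (\<open>rank_conformal_neq_one\<close>). For a circle in a translate of this plane, both the differences of
  two points and the tangent vectors lie in the plane, hence never have rank one.

  The centres of the circles are the four diagonal matrices of the Tartar square. The difference of
  two of them has nonzero determinant in the upper left block, and this survives the addition of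
  the conformal matrix of any \<open>z\<close> with \<open>|z| \<le> 1/2\<close> (\<open>rank_tartar_perturbed\<close>); circles of radius one
  quarter therefore have no rank-one connections between them either.

  Being a \<open>T\<^sub>4\<close> configuration is invariant under translation. Shifting the Tartar square by a single
  conformal matrix with \<open>|z| = 1/4\<close> moves its four points from the centres onto the circles
  (\<open>T4_tartar_translate\<close>).\<close>

section \<open>Matrices of rank at most one\<close>

text \<open>All rows are multiples of one vector, so the two by two minors vanish. The contrapositive is
  how a rank above one is recognised below.\<close>

lemma rank_le_one_minor:
  fixes A :: "real^'n^'m"
  assumes "rank A \<le> 1"
  shows "A$i$j * A$k$l = A$i$l * A$k$j"
proof -
  obtain B where B: "B \<subseteq> rows A" "independent B" "rows A \<subseteq> span B" "card B = dim (rows A)"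
    using basis_exists[of "rows A"] by metis
  have "card B \<le> Suc 0"
    using B(4) assms by (simp add: row_rank_def)
  moreover have "finite B"
    using B(2) by (rule independent_imp_finite)
  ultimately obtain v where "B \<subseteq> {v}"
    by (metis card_le_Suc0_iff_eq empty_subsetI is_singletonI' is_singleton_the_elem subset_refl)
  then have "rows A \<subseteq> span {v}"
    using B(3) span_mono by blast
  moreover have "row i A \<in> rows A" "row k A \<in> rows A"
    by (auto simp: rows_def)
  ultimately obtain c d where "row i A = c *\<^sub>R v" "row k A = d *\<^sub>R v"
    unfolding span_singleton by blast
  then have "\<forall>x. A$i$x = c * v$x" "\<forall>x. A$k$x = d * v$x"
    by (simp_all add: row_def vec_eq_iff)
  then show ?thesis
    by simp
qed

section \<open>Matrices supported in the upper left block\<close>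

definition block :: "real \<Rightarrow> real \<Rightarrow> real \<Rightarrow> real \<Rightarrow> real^3^3" where
  "block a b c d = vector [vector [a, b, 0], vector [c, d, 0], 0]"

lemma block_nth [simp]:
  "block a b c d $ 1 = vector [a, b, 0]"
  "block a b c d $ 2 = vector [c, d, 0]"
  "block a b c d $ 3 = 0"
  by (simp_all add: block_def)

lemma block_eq_iff [simp]:
  "block a b c d = block a' b' c' d' \<longleftrightarrow> a = a' \<and> b = b' \<and> c = c' \<and> d = d'"
  by (auto simp: vec_eq_iff forall_3)

lemma block_add: "block a b c d + block a' b' c' d' = block (a + a') (b + b') (c + c') (d + d')"
  by (simp add: vec_eq_iff forall_3)

lemma block_diff: "block a b c d - block a' b' c' d' = block (a - a') (b - b') (c - c') (d - d')"
  by (simp add: vec_eq_iff forall_3)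

lemma block_scaleR: "x *\<^sub>R block a b c d = block (x * a) (x * b) (x * c) (x * d)"
  by (simp add: vec_eq_iff forall_3)

lemma block_zero: "block 0 0 0 0 = 0"
  by (simp add: vec_eq_iff forall_3)

lemma rank_block_gt_one:
  assumes "a * d - b * c \<noteq> 0"
  shows "rank (block a b c d) > 1"
  using rank_le_one_minor[of "block a b c d" 1 1 2 2] assms by force

lemma rank_eq_one_if_rows_parallel:
  fixes A :: "real^'n^'m"
  assumes "A \<noteq> 0" and "\<And>i. \<exists>c. A$i = c *\<^sub>R v"
  shows "rank A = 1"
proof -
  have "rows A \<subseteq> span {v}"
    using assms(2) by (auto simp: rows_def row_def span_singleton)
  then have "dim (rows A) \<le> card {v}"
    by (intro dim_le_card) auto
  then have "rank A \<le> 1"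
    by (simp add: row_rank_def)
  moreover have "rank A \<noteq> 0"
    using assms(1) by (simp add: rank_eq_0)
  ultimately show ?thesis by simp
qed

lemma rank_block_axis:
  assumes "x \<noteq> 0"
  shows "rank (block x 0 0 0) = 1" "rank (block 0 0 0 x) = 1"
proof -
  have "\<exists>c. block x 0 0 0 $ i = c *\<^sub>R axis 1 1" for i
    using exhaust_3[of i] 
    by (auto simp: vec_eq_iff forall_3 axis_def intro: exI[of _ x] exI[of _ 0])
  then show "rank (block x 0 0 0) = 1"
    using assms by (intro rank_eq_one_if_rows_parallel) (auto simp flip: block_zero)
  have "\<exists>c. block 0 0 0 x $ i = c *\<^sub>R axis 2 1" for i
    using exhaust_3[of i] 
    by (auto simp: vec_eq_iff forall_3 axis_def intro: exI[of _ x] exI[of _ 0])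
  then show "rank (block 0 0 0 x) = 1"
    using assms by (intro rank_eq_one_if_rows_parallel) (auto simp flip: block_zero)
qed

section \<open>A plane without rank-one matrices\<close>

definition conformal :: "complex \<Rightarrow> real^3^3" where
  "conformal z = block (Re z) (- Im z) (Im z) (Re z)"

lemma linear_conformal: "linear conformal"
  by (rule linearI) (simp_all add: conformal_def block_add block_scaleR)

lemmas conformal_zero = linear_0[OF linear_conformal]
lemmas conformal_diff = linear_diff[OF linear_conformal]
lemmas conformal_scaleR = linear_scale[OF linear_conformal]

lemma bounded_linear_conformal: "bounded_linear conformal"
  using linear_conformal by (simp add: linear_conv_bounded_linear)

lemma inj_conformal: "inj conformal"
  by (auto simp: inj_on_def conformal_def complex_eq_iff)

lemma rank_conformal_neq_one: "rank (conformal z) \<noteq> 1"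
proof (cases "z = 0")
  case False
  then have "Re z * Re z - (- Im z) * Im z \<noteq> 0"
    by (simp add: complex_eq_iff sum_squares_eq_zero_iff)
  from rank_block_gt_one[OF this] show ?thesis
    by (simp add: conformal_def)
qed (simp add: conformal_zero)

section \<open>The Tartar square\<close>

text \<open>The four points are numbered in the cyclic order in which the inner square with corners
  \<open>(-1,1), (-1,-1), (1,-1), (1,1)\<close> is traversed; each lies on the prolongation of one side of that
  square.\<close>

definition tartar1 :: "nat \<Rightarrow> real" where
  "tartar1 k = (if k = 1 then -1 else if k = 2 then 3 else if k = 3 then 1 else -3)"

definition tartar2 :: "nat \<Rightarrow> real" where
  "tartar2 k = (if k = 1 then -3 else if k = 2 then -1 else if k = 3 then 3 else 1)"

definition tartar :: "nat \<Rightarrow> real^3^3" where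
  "tartar k = block (tartar1 k) 0 0 (tartar2 k)"

lemma tartar_values:
  "tartar1 1 = -1" "tartar1 2 = 3" "tartar1 3 = 1" "tartar1 4 = -3"
  "tartar2 1 = -3" "tartar2 2 = -1" "tartar2 3 = 3" "tartar2 4 = 1"
  by (simp_all add: tartar1_def tartar2_def)

lemma one_to_four: "{1..4::nat} = {1, 2, 3, 4}"
  by auto

text \<open>The first diagonal entry alone tells the four points apart. This makes it possible to
  separate the circles by open conditions on a single matrix entry.\<close>

lemma tartar1_gap:
  assumes "i \<in> {1..4}" "j \<in> {1..4}" "i \<noteq> j"
  shows "\<bar>tartar1 i - tartar1 j\<bar> \<ge> 2"
  using assms unfolding one_to_four by (auto simp: tartar_values[unfolded One_nat_def])

text \<open>With \<open>diag(x, y)\<close> the difference of the two points, the determinant of the upper left block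
  is \<open>xy + (x + y) Re z + |z|\<^sup>2\<close>. The first term has modulus at least 8, the others contribute at
  most \<open>8/2 + 1/4\<close>.\<close>

lemma rank_tartar_perturbed:
  assumes "i \<in> {1..4}" "j \<in> {1..4}" "i \<noteq> j" and z: "norm z \<le> 1/2"
  shows "rank (tartar i - tartar j + conformal z) > 1"
proof -
  define x y where "x = tartar1 i - tartar1 j" and "y = tartar2 i - tartar2 j"
  have xy: "\<bar>x * y\<bar> \<ge> 8" "\<bar>x + y\<bar> \<le> 8"
    using assms(1-3) unfolding one_to_four x_def y_def by (auto simp: tartar_values[unfolded One_nat_def])
  have "\<bar>(x + y) * Re z\<bar> \<le> 8 * (1/2)"
    unfolding abs_mult using xy(2) abs_Re_le_cmod[of z] z by (intro mult_mono) auto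
  moreover have "(norm z)\<^sup>2 \<le> (1/2)\<^sup>2"
    using z by (intro power_mono) auto
  then have "Re z * Re z + Im z * Im z \<le> 1/4"
    unfolding cmod_power2 by (simp add: power2_eq_square)
  moreover have "Re z * Re z + Im z * Im z \<ge> 0"
    by simp
  ultimately have "x * y + (x + y) * Re z + (Re z * Re z + Im z * Im z) \<noteq> 0"
    using xy(1) by linarith
  then have "(x + Re z) * (y + Re z) - (- Im z) * Im z \<noteq> 0"
    by (simp add: algebra_simps)
  from rank_block_gt_one[OF this] show ?thesis
    by (simp add: tartar_def conformal_def block_add block_diff x_def y_def)
qed

section \<open>Four small circles\<close>

definition circle :: "nat \<Rightarrow> (real^3^3) set" where
  "circle k = (\<lambda>z. tartar k + conformal z) ` sphere 0 (1/4)"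

definition circles :: "(real^3^3) set" where
  "circles = (\<Union>k\<in>{1..4}. circle k)"

lemma circlesE:
  assumes "X \<in> circles"
  obtains k z where "k \<in> {1..4}" "norm z = 1/4" "X = tartar k + conformal z"
proof -
  obtain k where "k \<in> {1..4}" "X \<in> circle k"
    using assms unfolding circles_def by blast
  moreover from this(2) obtain z where "z \<in> sphere 0 (1/4)" "X = tartar k + conformal z"
    unfolding circle_def by blast
  ultimately show thesis
    using that[of k z] by simp
qed

lemma compact_circles: "compact circles"
  unfolding circles_def circle_def
  by (intro compact_UN compact_continuous_image continuous_intros
      bounded_linear.continuous_on[OF bounded_linear_conformal]) auto

lemma circle_near_iff:
  assumes "X \<in> circle i" "i \<in> {1..4}" "k \<in> {1..4}"
  shows "\<bar>X$1$1 - tartar1 k\<bar> < 1 \<longleftrightarrow> i = k"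
proof -
  obtain z where z: "norm z = 1/4" "X = tartar i + conformal z"
    using assms(1) by (auto simp: circle_def)
  have "\<bar>X$1$1 - tartar1 i\<bar> \<le> 1/4"
    using abs_Re_le_cmod[of z] z by (simp add: tartar_def conformal_def)
  then show ?thesis
    using tartar1_gap[OF assms(2,3)] by (cases "i = k") (simp, linarith)
qed

lemma no_rank_one_connection_circles: "\<not> has_rank_one_connection circles"
proof -
  have "rank (A - B) \<noteq> 1" if mem: "A \<in> circles" "B \<in> circles" for A B
  proof -
    obtain i w where A: "i \<in> {1..4}" "norm w = 1/4" "A = tartar i + conformal w"
      using mem(1) by (rule circlesE)
    obtain j z where B: "j \<in> {1..4}" "norm z = 1/4" "B = tartar j + conformal z"
      using mem(2) by (rule circlesE)
    have *: "A - B = tartar i - tartar j + conformal (w - z)"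
      by (simp add: A B conformal_diff)
    show ?thesis
    proof (cases "i = j")
      case True
      then show ?thesis
        using * rank_conformal_neq_one[of "w - z"] by simp
    next
      case False
      have "norm (w - z) \<le> 1/2"
        using norm_triangle_ineq4[of w z] A B by simp
      with False show ?thesis
        using * rank_tartar_perturbed[OF A(1) B(1)] by (metis less_irrefl)
    qed
  qed
  then show ?thesis
    by (auto simp: has_rank_one_connection_def)
qed

text \<open>By continuity a curve in the union stays for a short time in the circle where it starts.
  Its difference quotients are then conformal, and so is their limit because a finite-dimensional
  subspace is closed.\<close>

lemma elliptic_circles: "elliptic circles"
  unfolding elliptic_def
proof (intro ballI)
  fix p A assume "p \<in> circles" and "A \<in> tangent_space circles p"
  then obtain e c where e: "e > 0" and c: "c ` {-e<..<e} \<subseteq> circles" "c 0 = p"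
    and deriv: "(c has_vector_derivative A) (at 0)"
    unfolding tangent_space_def by auto
  obtain k where k: "k \<in> {1..4}" "p \<in> circle k"
    using \<open>p \<in> circles\<close> by (auto simp: circles_def)
  have cont: "isCont c 0"
    using deriv by (rule has_vector_derivative_continuous)
  have "open {X :: real^3^3. \<bar>X$1$1 - tartar1 k\<bar> < 1}"
    by (intro open_Collect_less continuous_intros)
  then have "\<forall>\<^sub>F t in at 0. c t \<in> {X. \<bar>X$1$1 - tartar1 k\<bar> < 1}"
    using cont k c(2) circle_near_iff[OF k(2) k(1) k(1)]
    by (intro topological_tendstoD[OF cont[unfolded isCont_def]]) auto
  moreover have "\<forall>\<^sub>F t in at 0. t \<in> {-e<..<e}"
    using e by (intro eventually_at_in_open') auto
  ultimately have "\<forall>\<^sub>F t in at 0. (1/t) *\<^sub>R (c t - c 0) \<in> range conformal"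
  proof eventually_elim
    case (elim t)
    obtain i where i: "i \<in> {1..4}" "c t \<in> circle i"
      using elim(2) c(1) unfolding circles_def by blast
    then have "c t \<in> circle k"
      using elim(1) circle_near_iff[OF i(2) i(1) k(1)] by simp
    then obtain w z where "c t = tartar k + conformal w" "c 0 = tartar k + conformal z"
      using k(2) c(2) by (auto simp: circle_def)
    then have "(1/t) *\<^sub>R (c t - c 0) = conformal ((1/t) *\<^sub>R (w - z))"
      by (simp add: conformal_diff conformal_scaleR)
    then show ?case by blast
  qed
  moreover have "((\<lambda>t. (1/t) *\<^sub>R (c t - c 0)) \<longlongrightarrow> A) (at 0)"
  proof -
    have "((\<lambda>t. (c t - (c 0 + t *\<^sub>R A)) /\<^sub>R norm t) \<longlongrightarrow> 0) (at 0)"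
      using deriv unfolding has_vector_derivative_def has_derivative_def by (simp add: diff_diff_eq)
    then have "((\<lambda>t. norm ((c t - (c 0 + t *\<^sub>R A)) /\<^sub>R norm t)) \<longlongrightarrow> 0) (at 0)"
      by (rule tendsto_norm_zero)
    moreover have "\<forall>\<^sub>F t in at 0. norm ((c t - (c 0 + t *\<^sub>R A)) /\<^sub>R norm t)
        = norm ((1/t) *\<^sub>R (c t - c 0) - A)"
      unfolding eventually_at_filter
    proof (intro always_eventually allI impI)
      fix t :: real assume "t \<noteq> 0"
      then have "(1/t) *\<^sub>R (c t - c 0) - A = (1/t) *\<^sub>R (c t - (c 0 + t *\<^sub>R A))"
        by (simp add: scaleR_right_diff_distrib scaleR_right_distrib)
      then show "norm ((c t - (c 0 + t *\<^sub>R A)) /\<^sub>R norm t) = norm ((1/t) *\<^sub>R (c t - c 0) - A)"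
        by (simp add: divide_inverse_commute)
    qed
    ultimately have "((\<lambda>t. norm ((1/t) *\<^sub>R (c t - c 0) - A)) \<longlongrightarrow> 0) (at 0)"
      by (rule Lim_transform_eventually)
    then show ?thesis
      by (rule LIM_zero_cancel[OF tendsto_norm_zero_cancel])
  qed
  moreover have "closed (range conformal)"
    by (intro closed_subspace linear_conformal linear_subspace_image subspace_UNIV)
  ultimately have "A \<in> range conformal"
    by (intro Lim_in_closed_set[of "range conformal" "\<lambda>t. (1/t) *\<^sub>R (c t - c 0)" "at 0" A]) simp_all
  then show "rank A \<noteq> 1"
    using rank_conformal_neq_one by blast
qed

text \<open>Near a point the circle is parametrized by the angle measured from that point. The inverse is
  the principal argument, which is continuous off the closed negative real axis, so the chart covers
  the circle with only the antipodal point removed.\<close>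

lemma submanifold1_circles: "submanifold1 circles"
  unfolding submanifold1_def
proof (intro ballI)
  fix p assume "p \<in> circles"
  then obtain k w where k: "k \<in> {1..4}" and w: "norm w = 1/4" and p: "p = tartar k + conformal w"
    by (rule circlesE)
  have "w \<noteq> 0"
    using w by auto
  \<comment> \<open>On the circle, \<open>coord\<close> recovers \<open>z\<close> relative to the base point \<open>w\<close>; it is defined on all
    matrices so that the chart domain \<open>V\<close> is an open set of matrices.\<close>
  define coord where "coord X = Complex (X$1$1 - tartar1 k) (X$2$1) / w" for X :: "real^3^3"
  have coord: "coord (tartar k + conformal z) = z / w" for z
    by (simp add: coord_def tartar_def conformal_def complex_eq_iff)
  have cont_coord: "continuous_on UNIV coord"
    unfolding coord_def Complex_eq using \<open>w \<noteq> 0\<close> by (intro continuous_intros) auto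
  define V where "V = {X. \<bar>X$1$1 - tartar1 k\<bar> < 1} \<inter> coord -` (- \<real>\<^sub>\<le>\<^sub>0)"
  define I where "I = {-pi<..<pi}"
  define g where "g t = tartar k + conformal (w * cis t)" for t
  define h where "h X = Arg (coord X)" for X
  \<comment> \<open>The \<open>n\<close>-th derivative of \<open>g\<close>: differentiating \<open>cis\<close> multiplies it by \<open>\<i>\<close>, and the constant
    centre contributes only for \<open>n = 0\<close>.\<close>
  define D where "D n t = (if n = 0 then tartar k else 0) + conformal (w * (\<i> ^ n * cis t))"
    for n :: nat and t
  have D: "(D n has_vector_derivative D (Suc n) t) (at t)" for n t
  proof -
    have "(cis has_vector_derivative \<i> * cis t) (at t)"
      by (auto intro!: derivative_eq_intros simp: has_vector_derivative_complex_iff)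
    then have "((\<lambda>t. w * (\<i> ^ n * cis t)) has_vector_derivative w * (\<i> ^ n * (\<i> * cis t))) (at t)"
      by (intro has_vector_derivative_mult_right)
    from bounded_linear.has_vector_derivative[OF bounded_linear_conformal this] show ?thesis
      unfolding D_def by (auto intro!: derivative_eq_intros simp: mult_ac)
  qed
  have D0: "D 0 = g"
    by (simp add: D_def g_def fun_eq_iff)
  have smooth: "smooth_curve_on I g"
    unfolding smooth_curve_on_def using D D0 by blast
  have regular: "vector_derivative g (at t) \<noteq> 0" for t
  proof -
    have "vector_derivative g (at t) = conformal (w * (\<i> * cis t))"
      using vector_derivative_at[OF D[of 0 t]] by (simp add: D0) (simp add: D_def)
    moreover have "w * (\<i> * cis t) \<noteq> 0"
      using \<open>w \<noteq> 0\<close> by simp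
    ultimately show ?thesis
      using inj_conformal by (metis conformal_zero injD)
  qed
  have open_V: "open V"
    unfolding V_def using cont_coord
    by (intro open_Int open_Collect_less continuous_intros open_vimage) auto
  have on_circle: "tartar k + conformal z \<in> circle k" if "norm z = 1/4" for z
    using that by (auto simp: circle_def)
  have in_V: "tartar k + conformal z \<in> V \<longleftrightarrow> z / w \<notin> \<real>\<^sub>\<le>\<^sub>0" if "norm z = 1/4" for z
    using circle_near_iff[OF on_circle[OF that] k k] by (simp add: V_def coord)
  have "p \<in> V"
    using w \<open>w \<noteq> 0\<close> in_V by (simp add: p)
  have Arg_cis: "Arg (cis t) = t" if "t \<in> I" for t
    using that by (intro cis_Arg_unique) (auto simp: I_def sgn_div_norm)
  have cis_slit: "cis t \<notin> \<real>\<^sub>\<le>\<^sub>0" if "t \<in> I" for t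
  proof
    assume "cis t \<in> \<real>\<^sub>\<le>\<^sub>0"
    moreover have "cis t \<noteq> 0"
      by simp
    ultimately have "Re (cis t) < 0 \<and> Im (cis t) = 0"
      by (auto simp: complex_nonpos_Reals_iff complex_eq_iff less_le simp del: cis_neq_zero)
    then have "Arg (cis t) = pi"
      by (simp only: Arg_eq_pi)
    then show False
      using Arg_cis[OF that] that by (simp add: I_def)
  qed
  have norm_param: "norm (w * cis t) = 1/4" for t
    by (simp add: norm_mult w)
  have "homeomorphism I (circles \<inter> V) g h"
  proof (rule homeomorphismI)
    show "continuous_on I g"
      unfolding g_def by (intro continuous_intros bounded_linear.continuous_on[OF bounded_linear_conformal])
    show "continuous_on (circles \<inter> V) h"
      unfolding h_def
      by (rule continuous_on_compose2[OF continuous_on_Arg])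
         (auto intro: continuous_on_subset[OF cont_coord] simp: V_def)
    show "g ` I \<subseteq> circles \<inter> V"
      using k on_circle in_V cis_slit norm_param \<open>w \<noteq> 0\<close>
      by (auto simp: g_def circles_def)
    show "h (g t) = t" if "t \<in> I" for t
      using Arg_cis[OF that] \<open>w \<noteq> 0\<close> by (simp add: h_def g_def coord)
    have inverse: "h X \<in> I \<and> g (h X) = X" if "X \<in> circles \<inter> V" for X
    proof -
      obtain i where i: "i \<in> {1..4}" "X \<in> circle i"
        using \<open>X \<in> circles \<inter> V\<close> by (auto simp: circles_def)
      then have "i = k"
        using that circle_near_iff[OF i(2) i(1) k] by (simp add: V_def)
      then obtain z where z: "norm z = 1/4" "X = tartar k + conformal z"
        using i by (auto simp: circle_def)
      have slit: "z / w \<notin> \<real>\<^sub>\<le>\<^sub>0"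
        using that in_V z by simp
      have "h X = Arg (z / w)"
        by (simp add: h_def z coord)
      moreover have "Arg (z / w) \<in> I"
        using Arg_bounded[of "z / w"] slit Arg_eq_pi[of "z / w"]
        by (auto simp: I_def complex_nonpos_Reals_iff less_le)
      moreover have "cis (Arg (z / w)) = z / w"
      proof (subst cis_Arg)
        have "norm (z / w) = 1"
          unfolding norm_divide z(1) w by simp
        then show "sgn (z / w) = z / w"
          unfolding sgn_div_norm by simp
      qed (use slit in auto)
      ultimately show ?thesis
        using \<open>w \<noteq> 0\<close> by (simp add: g_def z)
    qed
    show "h ` (circles \<inter> V) \<subseteq> I"
      using inverse by blast
    show "g (h X) = X" if "X \<in> circles \<inter> V" for X
      using inverse that by blast
  qed
  then show "\<exists>V I g h. open V \<and> p \<in> V \<and> open I \<and> smooth_curve_on I (g :: real \<Rightarrow> real^3^3) \<and>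
      (\<forall>t\<in>I. vector_derivative g (at t) \<noteq> 0) \<and> homeomorphism I (circles \<inter> V) g h"
    using open_V \<open>p \<in> V\<close> smooth regular by (metis I_def open_greaterThanLessThan)
qed

text \<open>The rank-one steps \<open>R k\<close> are the sides of the inner square, starting from the corner
  \<open>(-1,1)\<close>. Every side has length two and is prolonged by its own length, whence \<open>\<kappa> = 2\<close>
  throughout. The translation is absorbed by the base point \<open>P\<close>.\<close>

lemma T4_tartar_translate: "T4_configuration ((\<lambda>k. tartar k + conformal z) ` {1..4})"
proof -
  define R where "R k = (if k = 1 then block 0 0 0 (-2) else if k = 2 then block 2 0 0 0
      else if k = 3 then block 0 0 0 2 else block (-2) 0 0 0)" for k :: nat
  define P where "P = block (-1) 0 0 1 + conformal z"
  have "rank (tartar i + conformal z - (tartar j + conformal z)) > 1"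
    if "i \<in> {1..4}" "j \<in> {1..4}" "i \<noteq> j" for i j
    using rank_tartar_perturbed[OF that, of 0] by (simp add: conformal_zero)
  moreover have "\<forall>k\<in>{1..4}. rank (R k) = 1"
    by (simp add: R_def rank_block_axis)
  moreover have "(\<Sum>k=1..4. R k) = 0"
    unfolding one_to_four by (simp add: R_def block_add block_zero)
  moreover have "\<forall>k\<in>{1..4}. tartar k + conformal z = P + (\<Sum>i=1..<k. R i) + 2 *\<^sub>R R k"
  proof -
    have "{1..<2::nat} = {1}" "{1..<3::nat} = {1, 2}" "{1..<4::nat} = {1, 2, 3}"
      by auto
    then show ?thesis
      unfolding one_to_four by (simp add: R_def P_def tartar_def tartar_values[unfolded One_nat_def] conformal_def
          block_add block_scaleR)
  qed
  ultimately show ?thesis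
    unfolding T4_configuration_def
    by (intro exI[of _ "\<lambda>k. tartar k + conformal z"] exI[of _ P] exI[of _ R] exI[of _ "\<lambda>_. 2"]) auto
qed

theorem proposition5p1:
  shows "\<exists>M :: (real^3^3) set.
    submanifold1 M \<and> compact M \<and> elliptic M \<and> \<not> has_rank_one_connection M \<and>
    (\<exists>T. T \<subseteq> M \<and> T4_configuration T)"
proof -
  have "(\<lambda>k. tartar k + conformal (1/4)) ` {1..4} \<subseteq> circles"
    by (auto simp: circles_def circle_def norm_divide)
  then show ?thesis
    using submanifold1_circles compact_circles elliptic_circles no_rank_one_connection_circles
      T4_tartar_translate by blast
qed

end
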